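(* Let $n \ge 1$ and $k \ge 1$ be integers. Then $$S_{2k-1} = \Omega_k \begin{vmatrix} \binom{2}{1} & 0 & 0 & \cdots & 0 & 8S_1 \\ \binom{4}{1} & \binom{4}{3} & 0 & \cdots & 0 & (1+8S_1)^2 -1 \\ \binom{6}{1} & \binom{6}{3} & \binom{6}{5} & \cdots & 0 & (1+8S_1)^3 -1 \\ \vdots & \vdots & \vdots & \ddots & \vdots & \vdots \\ \binom{2k-2}{1} & \binom{2k-2}{3} & \binom{2k-2}{5} & \cdots & \binom{2k-2}{2k-3} & (1+8S_1)^{k-1}-1 \\ \binom{2k}{1} & \binom{2k}{3} & \binom{2k}{5} & \cdots & \binom{2k}{2k-3} & (1+8S_1)^{k} - 1 \end{vmatrix}, \qquad \Omega_k = \frac{1}{k!\, 8^k}.$$ That is, the determinant is that of the $k\times k$ matrix whose $(i,j)$ entry is $\binom{2i}{2j-1}$ for $1 \le i \le k$, $1 \le j \le k-1$ (which is $0$ when $j>i$), and whose $(i,k)$ entry is $(1+8S_1)^{i}-1$ for $1 \le i \le k$. Furthermore, for $k \ge 2$, this gives $S_{2k-1}$ as $S_1^2$ times a polynomial in $S_1$ of degree $k-2$ (with coefficients independent of $n$).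
   Context: For integers $m \ge 0$ and $n \ge 1$, $S_m = 1^m + 2^m + \cdots + n^m$ denotes the sum of the $m$th powers of the first $n$ positive integers (the dependence on $n$ is suppressed in the notation). *)

theory Defs
  imports "Jordan_Normal_Form.Determinant" "HOL-Computational_Algebra.Polynomial"
begin

definition power_sum :: "nat \<Rightarrow> nat \<Rightarrow> rat" where
  "power_sum m n = (\<Sum>i = 1..n. of_nat i ^ m)"

(* Matrix indices start at 0, so position (i, j) holds the entry in row i + 1, column j + 1.
   The binomial coefficients vanish strictly above the diagonal. *)
definition faulhaber_mat :: "nat \<Rightarrow> rat \<Rightarrow> rat mat" where
  "faulhaber_mat k s = mat k k (\<lambda>(i, j).
     if j + 1 < k then of_nat ((2 * (i + 1)) choose (2 * (j + 1) - 1))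
     else (1 + 8 * s) ^ (i + 1) - 1)"

definition Omega :: "nat \<Rightarrow> rat" where
  "Omega k = 1 / (fact k * 8 ^ k)"

end

theory Submission
  imports Defs
begin

text \<open>
  The idea is to telescope the differences $(2r+1)^{2i} - (2r-1)^{2i}$ over $1 \le r \le n$. Only odd
  powers of $r$ survive in each difference, so
  $$\sum_{l=1}^{i} \binom{2i}{2l-1} 4^l S_{2l-1} = (2n+1)^{2i} - 1 = (1 + 8 S_1)^i - 1,$$
  where the last step uses $(2n+1)^2 = 1 + 8 S_1$ (lemma \<open>power_sum_system\<close>). For $i = 1, \dots, k$
  this is a lower triangular linear system in the unknowns $4^l S_{2l-1}$, and the determinant in
  question is exactly the numerator of Cramer's rule for the last unknown. The denominator is the
  product of the diagonal entries $\binom{2i}{2i-1} = 2i$, namely $2^k k!$; together with the factor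
  $4^k$ of the unknown it gives $\Omega_k$ (lemma \<open>Omega_det_faulhaber_mat\<close>).

  For the second claim the same system is solved over the polynomials in an indeterminate $s$ in
  place of $S_1$. Cramer's rule, applied pointwise, identifies the value of the last unknown with
  the determinant for every rational $s$. The shape of the solution is read off coefficientwise
  from the system: the coefficients of $s^k$ give that the degree is $k$, and the coefficients of
  $1$ and $s$ coincide on both sides for the sequence $s, 0, 0, \dots$, so that the solution is
  congruent to this sequence modulo $s^2$.
\<close>

section \<open>Cramer's rule for the triangular system\<close>

text \<open>
  Cramer's rule, obtained here from a factorisation: the matrix is $L U$, where $L$ is the full
  lower triangular matrix of binomial coefficients and $U$ is the identity matrix with its last
  column replaced by the solution $x$.
\<close>
lemma det_faulhaber_mat_Suc:
  fixes x :: "nat \<Rightarrow> rat"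
  assumes sys: "\<And>i. i \<le> m \<Longrightarrow>
    (\<Sum>l\<le>i. of_nat ((2 * i + 2) choose (2 * l + 1)) * x l) = (1 + 8 * s) ^ (i + 1) - 1"
  shows "det (faulhaber_mat (Suc m) s) = 2 ^ (m + 1) * fact (m + 1) * x m"
proof -
  define L :: "rat mat" where
    "L = mat (Suc m) (Suc m) (\<lambda>(i, j). of_nat ((2 * i + 2) choose (2 * j + 1)))"
  define U :: "rat mat" where
    "U = mat (Suc m) (Suc m) (\<lambda>(i, j). if j = m then x i else if i = j then 1 else 0)"
  have L: "L \<in> carrier_mat (Suc m) (Suc m)" and U: "U \<in> carrier_mat (Suc m) (Suc m)"
    by (auto simp: L_def U_def)
  have "faulhaber_mat (Suc m) s = L * U"
  proof (rule eq_matI)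
    fix i j assume "i < dim_row (L * U)" "j < dim_col (L * U)"
    then have ij: "i \<le> m" "j \<le> m" by (auto simp: L_def U_def)
    have LU: "(L * U) $$ (i, j) = (\<Sum>l\<le>m. of_nat ((2 * i + 2) choose (2 * l + 1)) *
        (if j = m then x l else if l = j then 1 else 0))"
      using ij unfolding L_def U_def
      by (simp add: scalar_prod_def atLeast0LessThan lessThan_Suc_atMost)
    show "faulhaber_mat (Suc m) s $$ (i, j) = (L * U) $$ (i, j)"
    proof (cases "j = m")
      case True
      have "(L * U) $$ (i, j) = (\<Sum>l\<le>m. of_nat ((2 * i + 2) choose (2 * l + 1)) * x l)"
        using True LU by simp
      also have "\<dots> = (\<Sum>l\<le>i. of_nat ((2 * i + 2) choose (2 * l + 1)) * x l)"
        using ij by (intro sum.mono_neutral_right) (auto simp: binomial_eq_0)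
      finally show ?thesis using sys[OF ij(1)] ij True by (simp add: faulhaber_mat_def)
    next
      case False
      have "(L * U) $$ (i, j) =
          (\<Sum>l\<le>m. if l = j then of_nat ((2 * i + 2) choose (2 * l + 1)) else 0)"
        unfolding LU using False by (intro sum.cong) auto
      then show ?thesis using False ij by (simp add: faulhaber_mat_def)
    qed
  qed (auto simp: faulhaber_mat_def L_def U_def)
  moreover have "det L = 2 ^ (m + 1) * fact (m + 1)"
  proof -
    have "det L = prod_list (diag_mat L)"
      by (rule det_lower_triangular[OF _ L]) (auto simp: L_def binomial_eq_0)
    also have "\<dots> = (\<Prod>i\<in>{0..<Suc m}. L $$ (i, i))"
      using prod_list_diag_prod[of L] L by simp
    also have "\<dots> = (\<Prod>i\<in>{0..<Suc m}. 2 * of_nat (Suc i))"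
    proof (rule prod.cong)
      fix i assume "i \<in> {0..<Suc m}"
      then have "L $$ (i, i) = of_nat (Suc (2 * i + 1) choose (2 * i + 1))"
        by (simp add: L_def)
      then show "L $$ (i, i) = 2 * of_nat (Suc i)"
        by (simp only: binomial_Suc_n) simp
    qed simp
    also have "\<dots> = 2 ^ (m + 1) * fact (m + 1)"
      by (simp add: prod.distrib fact_prod_Suc del: fact_Suc prod.op_ivl_Suc of_nat_Suc)
    finally show ?thesis .
  qed
  moreover have "det U = x m"
  proof -
    have "upper_triangular U"
      unfolding upper_triangular_def by (auto simp: U_def)
    then have "det U = prod_list (diag_mat U)"
      by (rule det_upper_triangular[OF _ U])
    also have "\<dots> = (\<Prod>i\<in>{0..<Suc m}. U $$ (i, i))"
      using prod_list_diag_prod[of U] U by simp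
    also have "\<dots> = (\<Prod>i\<in>{0..<m}. 1) * x m"
      by (simp add: U_def)
    finally show ?thesis by simp
  qed
  ultimately show ?thesis
    by (simp add: det_mult[OF L U])
qed

lemma Omega_det_faulhaber_mat:
  fixes y :: "nat \<Rightarrow> rat"
  assumes sys: "\<And>i. i \<le> m \<Longrightarrow>
    (\<Sum>l\<le>i. of_nat ((2 * i + 2) choose (2 * l + 1)) * (4 ^ (l + 1) * y l)) = (1 + 8 * s) ^ (i + 1) - 1"
  shows "Omega (Suc m) * det (faulhaber_mat (Suc m) s) = y m"
proof -
  have "(8::rat) ^ (m + 1) = 2 ^ (m + 1) * 4 ^ (m + 1)"
    by (simp flip: power_mult_distrib)
  moreover have "det (faulhaber_mat (Suc m) s) = 2 ^ (m + 1) * fact (m + 1) * (4 ^ (m + 1) * y m)"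
    by (rule det_faulhaber_mat_Suc) (rule sys)
  ultimately show ?thesis
    by (simp add: Omega_def field_simps del: fact_Suc)
qed

section \<open>The system satisfied by the odd power sums\<close>

lemma sum_odd_indices:
  fixes g :: "nat \<Rightarrow> 'a :: comm_monoid_add"
  assumes "\<And>k. even k \<Longrightarrow> g k = 0"
  shows "(\<Sum>k\<le>2 * m. g k) = (\<Sum>j<m. g (2 * j + 1))"
  using assms by (induction m) auto

lemma odd_part_binomial:
  fixes t :: "'a :: comm_ring_1"
  shows "(t + 1) ^ (2 * m) - (t - 1) ^ (2 * m) =
    (\<Sum>j<m. of_nat ((2 * m) choose (2 * j + 1)) * (2 * t ^ (2 * j + 1)))"
proof -
  have "(t - 1) ^ (2 * m) = (1 - t) ^ (2 * m)"
    by (simp add: power_mult power2_commute)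
  also have "\<dots> = (- t + 1) ^ (2 * m)" by simp
  finally have "(t + 1) ^ (2 * m) - (t - 1) ^ (2 * m) =
      (\<Sum>k\<le>2 * m. of_nat ((2 * m) choose k) * (t ^ k - (- t) ^ k))"
    unfolding binomial_ring[of t] binomial_ring[of "- t"]
    by (simp add: algebra_simps flip: sum_subtractf)
  also have "\<dots> = (\<Sum>j<m. of_nat ((2 * m) choose (2 * j + 1)) *
      (t ^ (2 * j + 1) - (- t) ^ (2 * j + 1)))"
    by (rule sum_odd_indices) simp
  also have "\<dots> = (\<Sum>j<m. of_nat ((2 * m) choose (2 * j + 1)) * (2 * t ^ (2 * j + 1)))"
  proof (rule sum.cong)
    fix j
    have "(- t) ^ (2 * j + 1) = - (t ^ (2 * j + 1))"
      by (rule power_minus_odd) simp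
    then show "of_nat ((2 * m) choose (2 * j + 1)) * (t ^ (2 * j + 1) - (- t) ^ (2 * j + 1)) =
        of_nat ((2 * m) choose (2 * j + 1)) * (2 * t ^ (2 * j + 1))"
      by (simp only: diff_minus_eq_add mult_2[of "t ^ (2 * j + 1)"])
  qed simp
  finally show ?thesis .
qed

text \<open>
  Telescoping: the increment of the right-hand side from $n$ to $n+1$ is twice the odd part of a binomial
  expansion at $t = 2(n+1)$, and $2 t^{2l+1} = 4^{l+1} (n+1)^{2l+1}$.
\<close>
lemma power_sum_telescope:
  "(\<Sum>l\<le>i. of_nat ((2 * i + 2) choose (2 * l + 1)) * (4 ^ (l + 1) * power_sum (2 * l + 1) n)) =
    (2 * of_nat n + 1) ^ (2 * i + 2) - 1"
proof (induction n)
  case 0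
  show ?case by (simp add: power_sum_def)
next
  case (Suc n)
  let ?t = "2 * of_nat (Suc n) :: rat"
  have "(?t + 1) ^ (2 * Suc i) - (?t - 1) ^ (2 * Suc i) =
      (\<Sum>l\<le>i. of_nat ((2 * i + 2) choose (2 * l + 1)) * (4 ^ (l + 1) * of_nat (Suc n) ^ (2 * l + 1)))"
  proof -
    have "2 * ?t ^ (2 * l + 1) = 4 ^ (l + 1) * of_nat (Suc n) ^ (2 * l + 1)" for l
      by (simp only: power_mult_distrib power_add power_mult) simp
    then show ?thesis
      using odd_part_binomial[of ?t "Suc i"]
      by (simp only: lessThan_Suc_atMost mult_Suc_right add.commute[of 2])
  qed
  moreover have "?t - 1 = 2 * of_nat n + 1" by simp
  moreover have "power_sum (2 * l + 1) (Suc n) =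
      power_sum (2 * l + 1) n + of_nat (Suc n) ^ (2 * l + 1)" for l
    unfolding power_sum_def by (simp del: of_nat_Suc)
  ultimately show ?case
    using Suc.IH by (simp only: distrib_left sum.distrib) simp
qed

lemma power_sum_1: "1 + 8 * power_sum 1 n = (2 * of_nat n + 1) ^ 2"
proof (induction n)
  case 0
  show ?case by (simp add: power_sum_def)
next
  case (Suc n)
  have "power_sum 1 (Suc n) = power_sum 1 n + of_nat (Suc n)"
    by (simp add: power_sum_def)
  with Suc show ?case by (simp add: power2_eq_square algebra_simps)
qed

lemma power_sum_system:
  "(\<Sum>l\<le>i. of_nat ((2 * i + 2) choose (2 * l + 1)) * (4 ^ (l + 1) * power_sum (2 * l + 1) n)) =
    (1 + 8 * power_sum 1 n) ^ (i + 1) - 1"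
  unfolding power_sum_telescope power_sum_1 power_mult[symmetric]
  by (simp only: distrib_left mult_1_right)

section \<open>The polynomial solution\<close>

text \<open>
  Forward substitution in the triangular system over the polynomials. In the indexing from $0$,
  the solution is the Faulhaber polynomial that expresses $S_{2i+1}$ through $S_1$.
\<close>
fun faulhaber_poly :: "nat \<Rightarrow> rat poly" where
  "faulhaber_poly i = smult (1 / (of_nat (2 * i + 2) * 4 ^ (i + 1)))
     ([:1, 8:] ^ (i + 1) - 1 -
      (\<Sum>l<i. smult (of_nat ((2 * i + 2) choose (2 * l + 1)) * 4 ^ (l + 1)) (faulhaber_poly l)))"

declare faulhaber_poly.simps [simp del]

lemma faulhaber_poly_system:
  "(\<Sum>l\<le>i. smult (of_nat ((2 * i + 2) choose (2 * l + 1)) * 4 ^ (l + 1)) (faulhaber_poly l)) =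
    [:1, 8:] ^ (i + 1) - 1"
proof -
  have "(2 * i + 2) choose (2 * i + 1) = 2 * i + 2"
    using binomial_Suc_n[of "2 * i + 1"] by simp
  moreover have "smult (of_nat (2 * i + 2) * 4 ^ (i + 1)) (faulhaber_poly i) =
      [:1, 8:] ^ (i + 1) - 1 -
      (\<Sum>l<i. smult (of_nat ((2 * i + 2) choose (2 * l + 1)) * 4 ^ (l + 1)) (faulhaber_poly l))"
    by (subst faulhaber_poly.simps) (simp del: of_nat_add of_nat_mult of_nat_Suc power_Suc)
  ultimately show ?thesis
    by (simp only: lessThan_Suc_atMost[symmetric] sum.lessThan_Suc
      add_diff_cancel_left' diff_add_cancel add.commute)
qed

lemma Omega_det_eq_poly:
  "Omega (Suc m) * det (faulhaber_mat (Suc m) s) = poly (faulhaber_poly m) s"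
proof (rule Omega_det_faulhaber_mat)
  fix i
  show "(\<Sum>l\<le>i. of_nat ((2 * i + 2) choose (2 * l + 1)) * (4 ^ (l + 1) * poly (faulhaber_poly l) s)) =
      (1 + 8 * s) ^ (i + 1) - 1"
    using arg_cong[OF faulhaber_poly_system[of i], of "\<lambda>p. poly p s"]
    by (simp add: poly_sum mult.assoc mult.commute[of s] del: power_Suc)
qed

lemma coeff_faulhaber_poly:
  "of_nat (2 * i + 2) * 4 ^ (i + 1) * coeff (faulhaber_poly i) d =
    of_nat (Suc i choose d) * 8 ^ d - (if d = 0 then 1 else 0) -
    (\<Sum>l<i. of_nat ((2 * i + 2) choose (2 * l + 1)) * 4 ^ (l + 1) * coeff (faulhaber_poly l) d)"
proof -
  have "coeff ([:1, 8:] ^ (i + 1) - 1) d = of_nat (Suc i choose d) * 8 ^ d - (if d = 0 then 1 else (0::rat))"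
    by (cases "d \<le> i + 1")
      (auto simp: coeff_linear_poly_power binomial_eq_0 coeff_eq_0 degree_power_eq simp del: power_Suc)
  then show ?thesis
    by (subst faulhaber_poly.simps) (simp add: coeff_sum del: of_nat_add of_nat_mult of_nat_Suc power_Suc)
qed

lemma coeff_faulhaber_poly_high: "i + 1 < d \<Longrightarrow> coeff (faulhaber_poly i) d = 0"
proof (induction i rule: less_induct)
  case (less i)
  then show ?case
    using coeff_faulhaber_poly[of i d] by (simp add: binomial_eq_0)
qed

text \<open>
  All the earlier polynomials have smaller degree, so that the top coefficient comes from
  $(1+8s)^{i+1}$ alone.
\<close>
lemma degree_faulhaber_poly: "degree (faulhaber_poly i) = i + 1"
proof (rule antisym)
  show "degree (faulhaber_poly i) \<le> i + 1"
    by (rule degree_le) (use coeff_faulhaber_poly_high in blast)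
  have "coeff (faulhaber_poly i) (i + 1) \<noteq> 0"
    using coeff_faulhaber_poly[of i "i + 1"] by (auto simp: coeff_faulhaber_poly_high)
  then show "i + 1 \<le> degree (faulhaber_poly i)"
    by (rule le_degree)
qed

lemma coeff_faulhaber_poly_0: "coeff (faulhaber_poly i) 0 = 0"
proof (induction i rule: less_induct)
  case (less i)
  then show ?case
    using coeff_faulhaber_poly[of i 0] by simp
qed

text \<open>
  The linear coefficient of $(1+8s)^{i+1}$ is $8(i+1)$, which equals $4 \binom{2i+2}{1}$ and is thus
  already accounted for by the unknown of index $0$, the polynomial $s$ itself.
\<close>
lemma coeff_faulhaber_poly_1: "coeff (faulhaber_poly i) 1 = (if i = 0 then 1 else 0)"
proof (induction i rule: less_induct)
  case (less i)
  show ?case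
  proof (cases "i = 0")
    case True
    then show ?thesis using coeff_faulhaber_poly[of 0 1] by simp
  next
    case False
    have "(\<Sum>l<i. of_nat ((2 * i + 2) choose (2 * l + 1)) * 4 ^ (l + 1) * coeff (faulhaber_poly l) 1) =
        (\<Sum>l<i. if l = 0 then of_nat (2 * i + 2) * 4 else (0::rat))"
      using less by (intro sum.cong) auto
    also have "\<dots> = of_nat (2 * i + 2) * 4"
      using False by simp
    finally have "of_nat (2 * i + 2) * 4 ^ (i + 1) * coeff (faulhaber_poly i) 1 =
        of_nat (Suc i choose 1) * 8 ^ 1 - 0 - of_nat (2 * i + 2) * 4"
      using coeff_faulhaber_poly[of i 1] by (simp only: one_neq_zero if_False)
    also have "\<dots> = 0" by simp
    finally show ?thesis using False by simp
  qed
qed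

lemma faulhaber_poly_factor:
  obtains p where "faulhaber_poly (Suc m) = monom 1 2 * p" and "degree p = m"
proof -
  have "monom 1 2 dvd faulhaber_poly (Suc m)"
    using coeff_faulhaber_poly_0[of "Suc m"] coeff_faulhaber_poly_1[of "Suc m"]
    by (auto simp: monom_1_dvd_iff' less_2_cases_iff)
  then obtain p where p: "faulhaber_poly (Suc m) = monom 1 2 * p" ..
  have "faulhaber_poly (Suc m) \<noteq> 0"
    using degree_faulhaber_poly[of "Suc m"] by auto
  then have "degree (faulhaber_poly (Suc m)) = 2 + degree p"
    unfolding p by (subst degree_mult_eq) (auto simp: degree_monom_eq)
  then have "degree p = m"
    by (simp add: degree_faulhaber_poly)
  with p that show thesis by blast
qed

theorem mainTheorem5:
  fixes k :: nat
  assumes "k \<ge> 1"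
  shows "(\<forall>n\<ge>1. power_sum (2 * k - 1) n = Omega k * det (faulhaber_mat k (power_sum 1 n)))
    \<and> (k \<ge> 2 \<longrightarrow> (\<exists>p :: rat poly. degree p = k - 2 \<and>
          (\<forall>s. Omega k * det (faulhaber_mat k s) = s ^ 2 * poly p s) \<and>
          (\<forall>n\<ge>1. power_sum (2 * k - 1) n = power_sum 1 n ^ 2 * poly p (power_sum 1 n))))"
proof -
  obtain m where m: "k = Suc m" using assms by (cases k) auto
  have det: "power_sum (2 * k - 1) n = Omega k * det (faulhaber_mat k (power_sum 1 n))" for n
    using Omega_det_faulhaber_mat[of m "\<lambda>l. power_sum (2 * l + 1) n" "power_sum 1 n"]
    by (simp only: power_sum_system m) simp
  have "\<exists>p :: rat poly. degree p = k - 2 \<and>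
      (\<forall>s. Omega k * det (faulhaber_mat k s) = s ^ 2 * poly p s)" if k2: "k \<ge> 2"
  proof -
    obtain j where j: "m = Suc j" using k2 m by (cases m) auto
    obtain p where p: "faulhaber_poly m = monom 1 2 * p" "degree p = j"
      unfolding j by (rule faulhaber_poly_factor)
    have "Omega k * det (faulhaber_mat k s) = s ^ 2 * poly p s" for s
      unfolding m Omega_det_eq_poly p by (simp add: poly_monom)
    with p m j show ?thesis by auto
  qed
  with det show ?thesis by metis
qed

end
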